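(* There is an absolute constant $C > 0$ such that the following holds for all integers $n, d \ge 1$ and all reals $L > 0$, $R > 0$, $\epsilon \ge 0$, $\tau > 0$ with $\tau \ge 5 \epsilon R$. There is a deterministic server algorithm that, on every $R$-instance of the DLAGP problem with these parameters and for all valid client replies, issues at most $$C \cdot n \cdot \min\{ L R^2/\tau,\; L R/\epsilon \}$$ approximate gradient queries and outputs a vector $w \in \mathbb{R}^d$ with $f(w) - f(w^* ) \le \tau$. (When $\epsilon = 0$, $LR/\epsilon$ is read as $+\infty$.)
   Context: All norms are Euclidean. A differentiable function is $L$-smooth if its gradient is $L$-Lipschitz. DLAGP problem: there are $n$ clients; client $i \in \{1,\dots,n\}$ holds a convex, $L$-smooth function $\ell_i : \mathbb{R}^d \to \mathbb{R}$. Let $f(w) = \frac1n \sum_{i=1}^n \ell_i(w)$, assumed to attain its minimum; $w^*$ denotes a minimizer of $f$ of smallest norm. An $R$-instance is an instance with $\|w^*\| \le R$, where $R$ is known to the server. The server knows $n, d, L, R, \epsilon, \tau$, and obtains information about the $\ell_i$ only through approximate gradient queries: the server (adaptively) selects $i \in \{1,\dots,n\}$ and $w \in \mathbb{R}^d$, and client $i$ replies with a vector $v$ satisfying $\|v - \nabla \ell_i(w)\| \le \epsilon$. The reply may be an arbitrary (adversarially chosen) vector satisfying this inequality; such replies are called valid. *)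

theory Defs
  imports "HOL-Analysis.Analysis"
begin

section \<open>Euclidean spaces of varying dimension\<close>

text \<open>
  The constant in the theorem must not depend on the dimension, so the dimension has to be
  quantified inside the formula and cannot be a type. All the spaces R^d are therefore realised
  inside one inner product space, the finitely supported real sequences, as the subspaces
  \<open>Rd d\<close> of the sequences vanishing from index \<open>d\<close> on. The lemmas \<open>ex1_Rd\<close>,
  \<open>inner_Rd\<close> and \<open>norm_Rd\<close> say that \<open>Rd d\<close> is Euclidean d-space.
\<close>

typedef fseq = "{x :: nat \<Rightarrow> real. finite {i. x i \<noteq> 0}}"
  morphisms coord Fseq
  by (rule exI[of _ "\<lambda>_. 0"]) simp

setup_lifting type_definition_fseq

lemma finite_coord [simp]: "finite {i. coord x i \<noteq> 0}"
  using coord[of x] by simp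

lemma fseq_eqI: "(\<And>i. coord x i = coord y i) \<Longrightarrow> x = y"
  by (simp add: coord_inject[symmetric] fun_eq_iff)

instantiation fseq :: real_vector
begin

lift_definition zero_fseq :: fseq is "\<lambda>_. 0" by simp

lift_definition plus_fseq :: "fseq \<Rightarrow> fseq \<Rightarrow> fseq" is "\<lambda>x y i. x i + y i"
  by (erule (1) rev_finite_subset[OF finite_UnI]) auto

lift_definition minus_fseq :: "fseq \<Rightarrow> fseq \<Rightarrow> fseq" is "\<lambda>x y i. x i - y i"
  by (erule (1) rev_finite_subset[OF finite_UnI]) auto

lift_definition uminus_fseq :: "fseq \<Rightarrow> fseq" is "\<lambda>x i. - x i"
  by simp

lift_definition scaleR_fseq :: "real \<Rightarrow> fseq \<Rightarrow> fseq" is "\<lambda>c x i. c * x i"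
  by (erule rev_finite_subset) auto

instance
  by standard (transfer; auto simp: fun_eq_iff algebra_simps)+

end

lemma coord_simps [simp]:
  "coord 0 i = 0"
  "coord (x + y) i = coord x i + coord y i"
  "coord (x - y) i = coord x i - coord y i"
  "coord (- x) i = - coord x i"
  "coord (c *\<^sub>R x) i = c * coord x i"
  by (transfer, simp)+

instantiation fseq :: real_inner
begin

definition inner_fseq :: "fseq \<Rightarrow> fseq \<Rightarrow> real" where
  "inner x y = (\<Sum>i | coord x i \<noteq> 0. coord x i * coord y i)"

definition norm_fseq :: "fseq \<Rightarrow> real" where
  "norm x = sqrt (inner x x)" for x :: fseq

definition dist_fseq :: "fseq \<Rightarrow> fseq \<Rightarrow> real" where
  "dist x y = norm (x - y)" for x y :: fseq

definition sgn_fseq :: "fseq \<Rightarrow> fseq" where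
  "sgn x = x /\<^sub>R norm x" for x :: fseq

definition uniformity_fseq_def:
  "(uniformity :: (fseq \<times> fseq) filter) = (INF e\<in>{0<..}. principal {(x, y). dist x y < e})"

definition open_fseq :: "fseq set \<Rightarrow> bool" where
  "open U \<longleftrightarrow> (\<forall>x\<in>U. eventually (\<lambda>(x', y). x' = x \<longrightarrow> y \<in> U) uniformity)" for U :: "fseq set"

lemma inner_fseq_superset:
  assumes "finite A" "\<And>i. i \<notin> A \<Longrightarrow> coord x i = 0 \<or> coord y i = 0"
  shows "inner x y = (\<Sum>i\<in>A. coord x i * coord y i)"
proof -
  let ?S = "{i. coord x i \<noteq> 0}"
  have "inner x y = (\<Sum>i\<in>?S \<union> A. coord x i * coord y i)"
    unfolding inner_fseq_def by (rule sum.mono_neutral_left) (use assms(1) in auto)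
  also have "\<dots> = (\<Sum>i\<in>A. coord x i * coord y i)"
    by (rule sum.mono_neutral_right) (use assms in auto)
  finally show ?thesis .
qed

instance
proof
  fix x y z :: fseq and r :: real
  let ?S = "\<lambda>x. {i. coord x i \<noteq> 0}"
  show "dist x y = norm (x - y)" by (rule dist_fseq_def)
  show "sgn x = x /\<^sub>R norm x" by (rule sgn_fseq_def)
  show "norm x = sqrt (inner x x)" by (rule norm_fseq_def)
  show "(uniformity :: (fseq \<times> fseq) filter) = (INF e\<in>{0<..}. principal {(x, y). dist x y < e})"
    by (rule uniformity_fseq_def)
  show "open U \<longleftrightarrow> (\<forall>x\<in>U. eventually (\<lambda>(x', y). x' = x \<longrightarrow> y \<in> U) uniformity)" for U :: "fseq set"
    by (rule open_fseq_def)
  have sup: "inner a z = (\<Sum>i\<in>?S z. coord a i * coord z i)" for a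
    by (rule inner_fseq_superset) auto
  show "inner x y = inner y x"
    by (subst inner_fseq_superset[of "?S y"]) (auto simp: inner_fseq_def mult.commute)
  show "inner (x + y) z = inner x z + inner y z"
    by (simp add: sup distrib_right sum.distrib)
  show "inner (r *\<^sub>R x) y = r * inner x y"
    by (subst inner_fseq_superset[of "?S x"]) (auto simp: inner_fseq_def sum_distrib_left mult.assoc)
  show "0 \<le> inner x x"
    by (simp add: inner_fseq_def sum_nonneg)
  show "inner x x = 0 \<longleftrightarrow> x = 0"
    by (auto simp: inner_fseq_def sum_nonneg_eq_0_iff intro: fseq_eqI)
qed

end

definition Rd :: "nat \<Rightarrow> fseq set" where
  "Rd d = {x. \<forall>i\<ge>d. coord x i = 0}"

lemma ex1_Rd: "\<exists>!x. x \<in> Rd d \<and> (\<forall>i<d. coord x i = a i)"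
proof (rule ex1I)
  have "finite {i. (if i < d then a i else 0) \<noteq> 0}"
    by (rule finite_subset[of _ "{..<d}"]) auto
  then show "Fseq (\<lambda>i. if i < d then a i else 0) \<in> Rd d \<and>
      (\<forall>i<d. coord (Fseq (\<lambda>i. if i < d then a i else 0)) i = a i)"
    by (auto simp: Rd_def Fseq_inverse)
next
  fix x assume "x \<in> Rd d \<and> (\<forall>i<d. coord x i = a i)"
  then have "coord x = (\<lambda>i. if i < d then a i else 0)"
    by (auto simp: Rd_def fun_eq_iff)
  then show "x = Fseq (\<lambda>i. if i < d then a i else 0)"
    by (metis coord_inverse)
qed

lemma inner_Rd: "x \<in> Rd d \<Longrightarrow> inner x y = (\<Sum>i<d. coord x i * coord y i)"
  by (rule inner_fseq_superset) (auto simp: Rd_def)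

lemma norm_Rd: "x \<in> Rd d \<Longrightarrow> norm x = L2_set (coord x) {..<d}"
  by (simp add: norm_eq_sqrt_inner inner_Rd L2_set_def power2_eq_square)

lemma subspace_Rd: "subspace (Rd d)"
  by (auto simp: subspace_def Rd_def)


section \<open>Gradients\<close>

definition has_gradient :: "nat \<Rightarrow> (fseq \<Rightarrow> real) \<Rightarrow> fseq \<Rightarrow> fseq \<Rightarrow> bool" where
  "has_gradient d l g w \<longleftrightarrow>
     g \<in> Rd d \<and> (l has_derivative (\<lambda>h. inner g h)) (at w within Rd d)"

lemma has_gradient_unique:
  assumes "has_gradient d l g w" "has_gradient d l g' w" "w \<in> Rd d"
  shows "g = g'"
proof -
  define u where "u = g - g'"
  have u: "u \<in> Rd d"
    using assms subspace_Rd by (auto simp: u_def has_gradient_def intro: subspace_diff)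
  let ?c = "\<lambda>t::real. w + t *\<^sub>R u"
  have c: "(?c has_derivative (\<lambda>t. t *\<^sub>R u)) (at 0)"
    by (auto intro!: derivative_eq_intros)
  have sub: "range ?c \<subseteq> Rd d"
    using u assms(3) subspace_Rd by (auto intro: subspace_add subspace_scale)
  have *: "((\<lambda>t. l (?c t)) has_derivative (\<lambda>t. inner a (t *\<^sub>R u))) (at 0)"
    if "has_gradient d l a w" for a
  proof -
    have "(l has_derivative inner a) (at (?c 0) within range ?c)"
      using that sub by (auto simp: has_gradient_def intro: has_derivative_subset)
    from has_derivative_in_compose[OF c this] show ?thesis by simp
  qed
  have "(\<lambda>t. inner g (t *\<^sub>R u)) = (\<lambda>t. inner g' (t *\<^sub>R u))"
    using has_derivative_unique[OF *[OF assms(1)] *[OF assms(2)]] .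
  from fun_cong[OF this, of 1] have "inner u u = 0"
    by (simp add: u_def inner_diff_left)
  then show ?thesis by (simp add: u_def)
qed

definition gradient :: "nat \<Rightarrow> (fseq \<Rightarrow> real) \<Rightarrow> fseq \<Rightarrow> fseq" where
  "gradient d l w = (THE g. has_gradient d l g w)"

definition smooth_Rd :: "nat \<Rightarrow> real \<Rightarrow> (fseq \<Rightarrow> real) \<Rightarrow> bool" where
  "smooth_Rd d L l \<longleftrightarrow>
     (\<forall>w\<in>Rd d. \<exists>g. has_gradient d l g w) \<and> L-lipschitz_on (Rd d) (gradient d l)"


section \<open>The DLAGP problem\<close>

text \<open>Clients are numbered from 0 to \<open>n - 1\<close>.\<close>

definition objective :: "nat \<Rightarrow> (nat \<Rightarrow> fseq \<Rightarrow> real) \<Rightarrow> fseq \<Rightarrow> real" where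
  "objective n l w = (1 / real n) * (\<Sum>i<n. l i w)"

definition minimizer :: "nat \<Rightarrow> (fseq \<Rightarrow> real) \<Rightarrow> fseq \<Rightarrow> bool" where
  "minimizer d f w \<longleftrightarrow> w \<in> Rd d \<and> (\<forall>x\<in>Rd d. f w \<le> f x)"

definition least_norm_minimizer :: "nat \<Rightarrow> (fseq \<Rightarrow> real) \<Rightarrow> fseq \<Rightarrow> bool" where
  "least_norm_minimizer d f w \<longleftrightarrow>
     minimizer d f w \<and> (\<forall>x. minimizer d f x \<longrightarrow> norm w \<le> norm x)"

definition R_instance ::
  "nat \<Rightarrow> nat \<Rightarrow> real \<Rightarrow> real \<Rightarrow> (nat \<Rightarrow> fseq \<Rightarrow> real) \<Rightarrow> fseq \<Rightarrow> bool" where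
  "R_instance n d L R l wstar \<longleftrightarrow>
     (\<forall>i<n. convex_on (Rd d) (l i) \<and> smooth_Rd d L (l i)) \<and>
     least_norm_minimizer d (objective n l) wstar \<and> norm wstar \<le> R"

text \<open>
  A deterministic adaptive server is a decision tree: \<open>Query i w K\<close> queries client \<open>i\<close> at
  \<open>w\<close> and continues as \<open>K v\<close> after the reply \<open>v\<close>. As a datatype, such a tree has no infinite
  branch, so a server always halts, but the lengths of its branches need not be bounded.
\<close>

datatype server = Output fseq | Query nat fseq "fseq \<Rightarrow> server"

primrec legal_server :: "nat \<Rightarrow> nat \<Rightarrow> server \<Rightarrow> bool" where
  "legal_server n d (Output w) \<longleftrightarrow> w \<in> Rd d"
| "legal_server n d (Query i w K) \<longleftrightarrow>
     i < n \<and> w \<in> Rd d \<and> (\<forall>v\<in>Rd d. legal_server n d (K v))"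

definition valid_reply ::
  "nat \<Rightarrow> real \<Rightarrow> (nat \<Rightarrow> fseq \<Rightarrow> real) \<Rightarrow> nat \<Rightarrow> fseq \<Rightarrow> fseq \<Rightarrow> bool" where
  "valid_reply d \<epsilon> l i w v \<longleftrightarrow> v \<in> Rd d \<and> norm (v - gradient d (l i) w) \<le> \<epsilon>"

text \<open>
  \<open>run d \<epsilon> l S q w\<close>: for some sequence of valid replies, \<open>S\<close> issues exactly \<open>q\<close> queries and
  outputs \<open>w\<close>. Replies are chosen anew at each query, also when a query is repeated.
\<close>

inductive run ::
  "nat \<Rightarrow> real \<Rightarrow> (nat \<Rightarrow> fseq \<Rightarrow> real) \<Rightarrow> server \<Rightarrow> nat \<Rightarrow> fseq \<Rightarrow> bool"
  for d :: nat and \<epsilon> :: real and l :: "nat \<Rightarrow> fseq \<Rightarrow> real" where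
  run_Output: "run d \<epsilon> l (Output w) 0 w"
| run_Query: "valid_reply d \<epsilon> l i x v \<Longrightarrow> run d \<epsilon> l (K v) q w \<Longrightarrow>
     run d \<epsilon> l (Query i x K) (Suc q) w"

text \<open>The case distinction is needed because \<open>x / 0 = 0\<close> in HOL.\<close>

definition query_rate :: "real \<Rightarrow> real \<Rightarrow> real \<Rightarrow> real \<Rightarrow> real" where
  "query_rate L R \<epsilon> \<tau> =
     (if \<epsilon> = 0 then L * R\<^sup>2 / \<tau> else min (L * R\<^sup>2 / \<tau>) (L * R / \<epsilon>))"

end

theory Submission
  imports Defs
begin

text \<open>
  Since \<open>\<tau> \<ge> 5 \<epsilon> R\<close>, the minimum in the query bound is always \<open>L R\<^sup>2 / \<tau>\<close>.
  If this is at most 1, then the origin is already good enough. Otherwise the server runs gradient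
  descent with step \<open>1 / (2 L)\<close>, projected onto the ball of radius \<open>R\<close>, and outputs the average
  of the iterates. The projection keeps all iterates within distance \<open>2 R\<close> of \<open>w\<^sup>*\<close>, so an
  error \<open>\<epsilon>\<close> in the gradient costs at most \<open>2 \<epsilon> R \<le> 2 \<tau> / 5\<close> per step on average, while the
  exact part of the error telescopes to \<open>L R\<^sup>2 / T\<close> after \<open>T\<close> steps.
\<close>

section \<open>Convex smooth functions\<close>

lemma has_gradient_gradient:
  assumes "smooth_Rd d L f" "w \<in> Rd d"
  shows "has_gradient d f (gradient d f w) w"
proof -
  obtain g where g: "has_gradient d f g w"
    using assms by (auto simp: smooth_Rd_def)
  show ?thesis
    unfolding gradient_def
    by (rule theI[where P = "\<lambda>g. has_gradient d f g w", OF g])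
      (rule has_gradient_unique[OF _ g assms(2)])
qed

lemma gradient_eqI:
  assumes "has_gradient d f g w" "w \<in> Rd d"
  shows "gradient d f w = g"
  unfolding gradient_def
  by (rule the_equality) (use assms has_gradient_unique in blast)+

lemma gradient_in_Rd: "smooth_Rd d L f \<Longrightarrow> w \<in> Rd d \<Longrightarrow> gradient d f w \<in> Rd d"
  using has_gradient_gradient by (auto simp: has_gradient_def)

lemma norm_gradient_diff_le:
  assumes "smooth_Rd d L f" "x \<in> Rd d" "y \<in> Rd d"
  shows "norm (gradient d f x - gradient d f y) \<le> L * norm (x - y)"
  using assms by (auto simp: smooth_Rd_def lipschitz_on_def dist_norm)

text \<open>The whole line stays in \<open>Rd d\<close>, so the derivative relative to the subspace
  becomes an ordinary two-sided derivative in one real variable.\<close>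

lemma has_gradient_along_line:
  assumes g: "has_gradient d f g x" and "x \<in> Rd d" "u \<in> Rd d"
  shows "((\<lambda>t. f (x + t *\<^sub>R u)) has_real_derivative inner g u) (at 0)"
proof -
  let ?c = "\<lambda>t::real. x + t *\<^sub>R u"
  have "(?c has_derivative (\<lambda>t. t *\<^sub>R u)) (at 0)"
    by (auto intro!: derivative_eq_intros)
  moreover have "range ?c \<subseteq> Rd d"
    using assms subspace_Rd by (auto intro: subspace_add subspace_scale)
  then have "(f has_derivative inner g) (at (?c 0) within range ?c)"
    using g by (auto simp: has_gradient_def intro: has_derivative_subset)
  ultimately have "((\<lambda>t. f (?c t)) has_derivative (\<lambda>t. inner g (t *\<^sub>R u))) (at 0)"
    by (rule has_derivative_in_compose)
  then show ?thesis
    by (rule has_derivative_imp_has_field_derivative) simp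
qed

text \<open>Convexity passes to the line through \<open>x\<close> and \<open>y\<close>, where the
  one-variable tangent inequality at 0, evaluated at 1, is the claim.\<close>

lemma convex_gradient_le:
  assumes cvx: "convex_on (Rd d) f" and g: "has_gradient d f g x" and xy: "x \<in> Rd d" "y \<in> Rd d"
  shows "f x + inner g (y - x) \<le> f y"
proof -
  let ?c = "\<lambda>t::real. x + t *\<^sub>R (y - x)"
  have u: "y - x \<in> Rd d"
    using xy subspace_Rd by (auto intro: subspace_diff)
  have c: "?c t \<in> Rd d" for t
    using xy u subspace_Rd by (auto intro: subspace_add subspace_scale)
  have "convex_on UNIV (\<lambda>t. f (?c t))"
  proof (rule convex_onI)
    fix t a b :: real
    assume t: "0 < t" "t < 1"
    have "?c ((1 - t) *\<^sub>R a + t *\<^sub>R b) = (1 - t) *\<^sub>R ?c a + t *\<^sub>R ?c b"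
      by (simp add: algebra_simps)
    then show "f (?c ((1 - t) *\<^sub>R a + t *\<^sub>R b)) \<le> (1 - t) * f (?c a) + t * f (?c b)"
      using convex_onD[OF cvx, of t "?c a" "?c b"] t c by auto
  qed simp
  from convex_on_imp_above_tangent[OF this, of 0 1 "inner g (y - x)"]
    has_gradient_along_line[OF g xy(1) u]
  show ?thesis by simp
qed

text \<open>Along the direction of the gradient itself the derivative is its squared norm, which
  must vanish at a two-sided minimum.\<close>

lemma gradient_minimizer:
  assumes "smooth_Rd d L f" "minimizer d f z"
  shows "gradient d f z = 0"
proof -
  let ?g = "gradient d f z"
  have z: "z \<in> Rd d" and min: "\<And>x. x \<in> Rd d \<Longrightarrow> f z \<le> f x"
    using assms by (auto simp: minimizer_def)
  have g: "?g \<in> Rd d"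
    by (rule gradient_in_Rd[OF assms(1) z])
  have "((\<lambda>t. f (z + t *\<^sub>R ?g)) has_real_derivative inner ?g ?g) (at 0)"
    by (rule has_gradient_along_line[OF has_gradient_gradient[OF assms(1) z] z g])
  moreover have "f (z + 0 *\<^sub>R ?g) \<le> f (z + t *\<^sub>R ?g)" for t
    using z g subspace_Rd by (auto intro!: min subspace_add subspace_scale)
  ultimately have "inner ?g ?g = 0"
    by (intro DERIV_local_min[where d = 1]) auto
  then show ?thesis by simp
qed

text \<open>The constant is \<open>L\<close> instead of the optimal \<open>L / 2\<close>: this follows from convexity alone,
  without integrating the gradient along the segment.\<close>

lemma convex_smooth_upper_bound:
  assumes cvx: "convex_on (Rd d) f" and sm: "smooth_Rd d L f" and xy: "x \<in> Rd d" "y \<in> Rd d"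
  shows "f y \<le> f x + inner (gradient d f x) (y - x) + L * (norm (y - x))\<^sup>2"
proof -
  let ?G = "gradient d f"
  have "f y + inner (?G y) (x - y) \<le> f x"
    by (rule convex_gradient_le[OF cvx has_gradient_gradient[OF sm xy(2)] xy(2) xy(1)])
  then have "f y \<le> f x + inner (?G x) (y - x) + inner (?G y - ?G x) (y - x)"
    by (simp add: inner_diff_left inner_diff_right)
  also have "inner (?G y - ?G x) (y - x) \<le> norm (?G y - ?G x) * norm (y - x)"
    by (rule norm_cauchy_schwarz)
  also have "\<dots> \<le> (L * norm (y - x)) * norm (y - x)"
    by (intro mult_right_mono norm_gradient_diff_le[OF sm xy(2) xy(1)]) simp
  finally show ?thesis by (simp add: power2_eq_square mult.assoc)
qed

text \<open>The upper bound is expanded at \<open>z\<close>, where the linear term vanishes. This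
  settles the case in which the server asks nothing.\<close>

lemma suboptimality_at_0:
  assumes cvx: "convex_on (Rd d) f" and sm: "smooth_Rd d L f" and min: "minimizer d f z"
    and "norm z \<le> R" "L > 0"
  shows "f 0 - f z \<le> L * R\<^sup>2"
proof -
  have z: "z \<in> Rd d" "0 \<in> Rd d"
    using min subspace_Rd by (auto simp: minimizer_def subspace_0)
  have "f 0 \<le> f z + L * (norm z)\<^sup>2"
    using convex_smooth_upper_bound[OF cvx sm z] gradient_minimizer[OF sm min] by simp
  moreover have "L * (norm z)\<^sup>2 \<le> L * R\<^sup>2"
    using assms by (intro mult_left_mono power_mono) auto
  ultimately show ?thesis by simp
qed


section \<open>The objective\<close>

lemma convex_on_objective:
  assumes "\<And>i. i < n \<Longrightarrow> convex_on (Rd d) (l i)"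
  shows "convex_on (Rd d) (objective n l)"
proof -
  have "convex_on (Rd d) (\<lambda>w. \<Sum>i<n. l i w)"
    using assms
  proof (induction n)
    case 0
    show ?case
      by (simp add: convex_on_def subspace_imp_convex subspace_Rd)
  next
    case (Suc n)
    then show ?case
      by (simp add: convex_on_add)
  qed
  then show ?thesis
    unfolding objective_def[abs_def] by (intro convex_on_cmul) auto
qed

lemma has_gradient_objective:
  assumes "\<And>i. i < n \<Longrightarrow> smooth_Rd d L (l i)" "w \<in> Rd d"
  shows "has_gradient d (objective n l) ((1 / real n) *\<^sub>R (\<Sum>i<n. gradient d (l i) w)) w"
proof -
  have "((\<lambda>w. (1 / real n) * (\<Sum>i<n. l i w)) has_derivative
      (\<lambda>h. (1 / real n) * (\<Sum>i<n. inner (gradient d (l i) w) h))) (at w within Rd d)"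
    using has_gradient_gradient[OF assms]
    by (intro has_derivative_mult_right has_derivative_sum) (auto simp: has_gradient_def)
  then show ?thesis
    using gradient_in_Rd[OF assms]
    by (auto simp: has_gradient_def objective_def[abs_def] inner_sum_left
        intro!: subspace_scale subspace_sum subspace_Rd)
qed

lemma gradient_objective:
  assumes "\<And>i. i < n \<Longrightarrow> smooth_Rd d L (l i)" "w \<in> Rd d"
  shows "gradient d (objective n l) w = (1 / real n) *\<^sub>R (\<Sum>i<n. gradient d (l i) w)"
  by (rule gradient_eqI, rule has_gradient_objective) (fact assms)+

lemma smooth_objective:
  assumes "\<And>i. i < n \<Longrightarrow> smooth_Rd d L (l i)" "n \<ge> 1" "L > 0"
  shows "smooth_Rd d L (objective n l)"
proof -
  have "norm (gradient d (objective n l) x - gradient d (objective n l) y) \<le> L * norm (x - y)"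
    if xy: "x \<in> Rd d" "y \<in> Rd d" for x y
  proof -
    have "gradient d (objective n l) x - gradient d (objective n l) y =
        (1 / real n) *\<^sub>R (\<Sum>i<n. gradient d (l i) x - gradient d (l i) y)"
      using gradient_objective[of n d L l x] gradient_objective[of n d L l y] assms(1) xy
      by (simp add: sum_subtractf scaleR_diff_right)
    also have "norm \<dots> = (1 / real n) * norm (\<Sum>i<n. gradient d (l i) x - gradient d (l i) y)"
      by simp
    also have "\<dots> \<le> (1 / real n) * (\<Sum>i<n. L * norm (x - y))"
      using assms(1) xy
      by (intro mult_left_mono sum_norm_le norm_gradient_diff_le) auto
    also have "\<dots> = L * norm (x - y)"
      using assms(2) by simp
    finally show ?thesis .
  qed
  then have "L-lipschitz_on (Rd d) (gradient d (objective n l))"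
    using assms(3) by (auto intro!: lipschitz_onI simp: dist_norm)
  moreover have "\<exists>g. has_gradient d (objective n l) g w" if "w \<in> Rd d" for w
    using has_gradient_objective[of n d L l w] assms(1) that by blast
  ultimately show ?thesis
    by (simp add: smooth_Rd_def)
qed


section \<open>Projected inexact gradient steps\<close>

text \<open>For \<open>R \<ge> 0\<close>, the nearest-point projection onto the closed ball around
  0. It only rescales, so it preserves subspaces.\<close>

definition proj_ball :: "real \<Rightarrow> 'a::real_inner \<Rightarrow> 'a" where
  "proj_ball R y = (if norm y \<le> R then y else (R / norm y) *\<^sub>R y)"

lemma norm_proj_ball: "R \<ge> 0 \<Longrightarrow> norm (proj_ball R y) \<le> R"
  by (auto simp: proj_ball_def)

lemma proj_ball_in_subspace: "subspace V \<Longrightarrow> y \<in> V \<Longrightarrow> proj_ball R y \<in> V"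
  by (auto simp: proj_ball_def subspace_scale)

text \<open>The variational inequality of the projection. The residual is a nonnegative multiple of
  \<open>y\<close>, and by Cauchy-Schwarz no point of the ball has a larger inner product with
  \<open>y\<close> than the projection has.\<close>

lemma proj_ball_obtuse:
  assumes "norm z \<le> R"
  shows "inner (y - proj_ball R y) (z - proj_ball R y) \<le> 0"
proof (cases "norm y \<le> R")
  case False
  have "R \<ge> 0"
    using assms norm_ge_zero order_trans by blast
  have ny: "norm y > 0"
    using False \<open>R \<ge> 0\<close> by linarith
  have "y - proj_ball R y = (1 - R / norm y) *\<^sub>R y"
    using False by (simp add: proj_ball_def scaleR_diff_left)
  moreover have "inner y (z - proj_ball R y) = inner y z - R * norm y"
    using False ny by (simp add: proj_ball_def inner_diff_right dot_square_norm power2_eq_square)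
  moreover have "inner y z \<le> norm y * R"
    using norm_cauchy_schwarz[of y z] mult_left_mono[OF assms, of "norm y"] by simp
  moreover have "1 - R / norm y \<ge> 0"
    using False ny by simp
  ultimately show ?thesis
    by (simp add: mult_nonneg_nonpos mult.commute)
qed (simp add: proj_ball_def)

definition pgd_step :: "real \<Rightarrow> real \<Rightarrow> fseq \<Rightarrow> fseq \<Rightarrow> fseq" where
  "pgd_step L R x g = proj_ball R (x - (1 / (2 * L)) *\<^sub>R g)"

lemma pgd_step_in_Rd: "x \<in> Rd d \<Longrightarrow> g \<in> Rd d \<Longrightarrow> pgd_step L R x g \<in> Rd d"
  unfolding pgd_step_def
  by (intro proj_ball_in_subspace subspace_Rd subspace_diff subspace_scale)

text \<open>Three inequalities are added: the upper bound from \<open>x\<close> to \<open>y\<close>,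
  the tangent at \<open>x\<close> evaluated at \<open>z\<close>, and the obtuse angle at
  \<open>y\<close>. The step \<open>1 / (2 * L)\<close> makes the terms
  \<open>L * (norm (y - x))\<^sup>2\<close> cancel. The gradient error is paired only with
  \<open>y - z\<close>, a difference of two points of the ball.\<close>

lemma pgd_step_progress:
  assumes cvx: "convex_on (Rd d) f" and sm: "smooth_Rd d L f"
    and x: "x \<in> Rd d" and z: "z \<in> Rd d" "norm z \<le> R" and g: "g \<in> Rd d"
    and err: "norm (g - gradient d f x) \<le> \<epsilon>" and L: "L > 0" and R: "R > 0"
  defines "y \<equiv> pgd_step L R x g"
  shows "f y - f z \<le> L * (norm (x - z))\<^sup>2 - L * (norm (y - z))\<^sup>2 + 2 * \<epsilon> * R"
proof -
  let ?G = "gradient d f x"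
  have y: "y \<in> Rd d"
    unfolding y_def by (rule pgd_step_in_Rd[OF x g])
  have ny: "norm y \<le> R"
    unfolding y_def pgd_step_def using R by (simp add: norm_proj_ball)
  have "inner (x - (1 / (2 * L)) *\<^sub>R g - y) (z - y) \<le> 0"
    unfolding y_def pgd_step_def by (rule proj_ball_obtuse[OF z(2)])
  then have "2 * L * inner (x - (1 / (2 * L)) *\<^sub>R g - y) (z - y) \<le> 0"
    using L by (simp add: mult_nonneg_nonpos)
  moreover have "x - (1 / (2 * L)) *\<^sub>R g - y = (x - y) - (1 / (2 * L)) *\<^sub>R g"
    by simp
  then have "2 * L * inner (x - (1 / (2 * L)) *\<^sub>R g - y) (z - y)
      = 2 * L * inner (x - y) (z - y) - inner g (z - y)"
    using L by (simp only: inner_diff_left[of "x - y"] inner_scaleR_left)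
      (simp add: right_diff_distrib)
  ultimately have "2 * L * inner (x - y) (z - y) + inner g (y - z) \<le> 0"
    by (simp add: inner_diff_right)
  \<comment> \<open>The law of cosines turns the angle condition into a difference of squared
    distances to \<open>z\<close>, which telescopes over the steps.\<close>
  moreover have "2 * inner (x - y) (z - y)
      = (norm (y - x))\<^sup>2 + (norm (y - z))\<^sup>2 - (norm (x - z))\<^sup>2"
    by (simp add: power2_norm_eq_inner inner_diff_left inner_diff_right inner_commute)
  then have "2 * L * inner (x - y) (z - y)
      = L * ((norm (y - x))\<^sup>2 + (norm (y - z))\<^sup>2 - (norm (x - z))\<^sup>2)"
    by (metis mult.assoc mult.commute)
  ultimately have obtuse: "inner g (y - z) \<le>
      L * (norm (x - z))\<^sup>2 - L * (norm (y - z))\<^sup>2 - L * (norm (y - x))\<^sup>2"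
    by (simp add: algebra_simps)
  have "inner (?G - g) (y - z) \<le> norm (?G - g) * norm (y - z)"
    by (rule norm_cauchy_schwarz)
  also have "\<dots> \<le> \<epsilon> * (2 * R)"
    using err norm_triangle_ineq4[of y z] ny z(2)
    by (intro mult_mono) (auto simp: norm_minus_commute intro: order_trans[OF norm_ge_zero err])
  finally have noise: "inner (?G - g) (y - z) \<le> 2 * \<epsilon> * R" by simp
  have "f y \<le> f x + inner ?G (y - x) + L * (norm (y - x))\<^sup>2"
    by (rule convex_smooth_upper_bound[OF cvx sm x y])
  moreover have "f x + inner ?G (z - x) \<le> f z"
    by (rule convex_gradient_le[OF cvx has_gradient_gradient[OF sm x] x z(1)])
  ultimately show ?thesis
    using obtuse noise by (simp add: inner_diff_left inner_diff_right)
qed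


section \<open>The server\<close>

text \<open>Continuation-passing style: the replies accumulate in \<open>s\<close>, and the rest of
  the decision tree is grafted on as \<open>K\<close>.\<close>

primrec query_clients :: "nat \<Rightarrow> fseq \<Rightarrow> fseq \<Rightarrow> (fseq \<Rightarrow> server) \<Rightarrow> server" where
  "query_clients 0 x s K = K s"
| "query_clients (Suc k) x s K = Query k x (\<lambda>v. query_clients k x (s + v) K)"

lemma legal_query_clients:
  assumes "k \<le> n" "x \<in> Rd d" "s \<in> Rd d" "\<And>s. s \<in> Rd d \<Longrightarrow> legal_server n d (K s)"
  shows "legal_server n d (query_clients k x s K)"
  using assms by (induction k arbitrary: s) (auto intro: subspace_add[OF subspace_Rd])

text \<open>Splits a run into one round of queries and a run of the continuation; the reply errors
  add up by the triangle inequality.\<close>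

lemma run_query_clients:
  assumes "run d \<epsilon> l (query_clients k x s K) q w" "s \<in> Rd d"
  shows "\<exists>q' s'. q = k + q' \<and> s' \<in> Rd d \<and>
    norm (s' - s - (\<Sum>i<k. gradient d (l i) x)) \<le> real k * \<epsilon> \<and> run d \<epsilon> l (K s') q' w"
  using assms
proof (induction k arbitrary: s q)
  case (Suc k)
  from Suc.prems(1) obtain v q0 where v: "valid_reply d \<epsilon> l k x v" "q = Suc q0"
      "run d \<epsilon> l (query_clients k x (s + v) K) q0 w"
    by (auto elim: run.cases)
  have "s + v \<in> Rd d"
    using v(1) Suc.prems(2) by (auto simp: valid_reply_def intro: subspace_add[OF subspace_Rd])
  from Suc.IH[OF v(3) this] obtain q' s' where *: "q0 = k + q'" "s' \<in> Rd d"
      "norm (s' - (s + v) - (\<Sum>i<k. gradient d (l i) x)) \<le> real k * \<epsilon>" "run d \<epsilon> l (K s') q' w"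
    by blast
  have "norm (s' - s - (\<Sum>i<Suc k. gradient d (l i) x)) =
      norm ((s' - (s + v) - (\<Sum>i<k. gradient d (l i) x)) + (v - gradient d (l k) x))"
    by (simp add: algebra_simps)
  also have "\<dots> \<le> real k * \<epsilon> + \<epsilon>"
    using v(1) by (intro norm_triangle_mono *(3)) (simp add: valid_reply_def)
  also have "\<dots> = real (Suc k) * \<epsilon>"
    by (simp add: algebra_simps)
  finally show ?case
    using * v(2) by (intro exI[of _ q'] exI[of _ s']) auto
qed auto

text \<open>In \<open>pgd_server n L R k j x m\<close>, the number of steps still to be made is \<open>k\<close>, and \<open>m\<close> is
  the average of the \<open>j\<close> iterates so far, the last of which is \<open>x\<close> (for \<open>j = 0\<close>, the
  starting point is \<open>x\<close> and \<open>m\<close> has no influence on the average).\<close>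

primrec pgd_server ::
  "nat \<Rightarrow> real \<Rightarrow> real \<Rightarrow> nat \<Rightarrow> nat \<Rightarrow> fseq \<Rightarrow> fseq \<Rightarrow> server" where
  "pgd_server n L R 0 j x m = Output m"
| "pgd_server n L R (Suc k) j x m = query_clients n x 0 (\<lambda>s.
     let y = pgd_step L R x ((1 / real n) *\<^sub>R s)
     in pgd_server n L R k (Suc j) y ((real j / real (Suc j)) *\<^sub>R m + (1 / real (Suc j)) *\<^sub>R y))"

lemma legal_pgd_server:
  assumes "x \<in> Rd d" "m \<in> Rd d"
  shows "legal_server n d (pgd_server n L R k j x m)"
  using assms
proof (induction k arbitrary: j x m)
  case (Suc k)
  show ?case
    unfolding pgd_server.simps Let_def
    using Suc.prems subspace_Rd
    by (intro legal_query_clients Suc.IH subspace_add subspace_scale pgd_step_in_Rd)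
      (auto simp: subspace_0)
qed simp

section \<open>Convergence of the averaged iterates\<close>

lemma convex_on_running_average:
  assumes cvx: "convex_on A f" and "m \<in> A" "y \<in> A"
  shows "real (Suc j) * f ((real j / real (Suc j)) *\<^sub>R m + (1 / real (Suc j)) *\<^sub>R y)
    \<le> real j * f m + f y"
proof -
  let ?t = "1 / real (Suc j)"
  have t: "1 - ?t = real j / real (Suc j)"
    by (simp add: field_simps)
  have "f ((1 - ?t) *\<^sub>R m + ?t *\<^sub>R y) \<le> (1 - ?t) * f m + ?t * f y"
    by (rule convex_onD[OF cvx]) (use assms in auto)
  then have "real (Suc j) * f ((1 - ?t) *\<^sub>R m + ?t *\<^sub>R y)
      \<le> real (Suc j) * ((1 - ?t) * f m + ?t * f y)"
    by (rule mult_left_mono) simp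
  also have "\<dots> = real j * f m + f y"
    by (simp add: t distrib_left del: of_nat_Suc)
  finally show ?thesis
    unfolding t .
qed

text \<open>The assumption \<open>inv\<close> is the sum of the progress bounds of the first
  \<open>j\<close> steps, with Jensen's inequality applied to the average \<open>m\<close>. Each
  step preserves it, and the induction is over the steps still to come.\<close>

lemma run_pgd_server:
  assumes cvx: "convex_on (Rd d) (objective n l)"
    and smooth: "\<And>i. i < n \<Longrightarrow> smooth_Rd d L (l i)"
    and n: "n \<ge> 1" and L: "L > 0" and R: "R > 0"
    and z: "z \<in> Rd d" "norm z \<le> R"
    and run: "run d \<epsilon> l (pgd_server n L R k j x m) q w"
    and x: "x \<in> Rd d" and m: "m \<in> Rd d"
    and inv: "real j * (objective n l m - objective n l z) + L * (norm (x - z))\<^sup>2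
      \<le> L * R\<^sup>2 + real j * (2 * \<epsilon> * R)"
  shows "q = k * n \<and> real (j + k) * (objective n l w - objective n l z)
    \<le> L * R\<^sup>2 + real (j + k) * (2 * \<epsilon> * R)"
  using run x m inv
proof (induction k arbitrary: j x m q)
  case 0
  have "q = 0" "w = m"
    using "0.prems"(1) by (auto elim: run.cases)
  \<comment> \<open>After the last step the remaining distance term is dropped.\<close>
  moreover have "L * (norm (x - z))\<^sup>2 \<ge> 0"
    using L by simp
  ultimately show ?case
    using "0.prems"(4) by simp
next
  case (Suc k)
  let ?f = "objective n l"
  obtain q' s where s: "q = n + q'" "s \<in> Rd d"
      "norm (s - 0 - (\<Sum>i<n. gradient d (l i) x)) \<le> real n * \<epsilon>"
      and run': "run d \<epsilon> l (let y = pgd_step L R x ((1 / real n) *\<^sub>R s)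
        in pgd_server n L R k (Suc j) y
          ((real j / real (Suc j)) *\<^sub>R m + (1 / real (Suc j)) *\<^sub>R y)) q' w"
    using run_query_clients[OF Suc.prems(1)[unfolded pgd_server.simps] subspace_0[OF subspace_Rd]]
    by blast
  define g where "g = (1 / real n) *\<^sub>R s"
  define y where "y = pgd_step L R x g"
  define m' where "m' = (real j / real (Suc j)) *\<^sub>R m + (1 / real (Suc j)) *\<^sub>R y"
  have run'': "run d \<epsilon> l (pgd_server n L R k (Suc j) y m') q' w"
    using run' by (simp only: Let_def g_def y_def m'_def)
  have g: "g \<in> Rd d"
    unfolding g_def using s(2) by (intro subspace_scale[OF subspace_Rd])
  have y: "y \<in> Rd d"
    unfolding y_def by (rule pgd_step_in_Rd[OF Suc.prems(2) g])
  have m': "m' \<in> Rd d"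
    unfolding m'_def using Suc.prems(3) y by (intro subspace_add subspace_scale subspace_Rd)
  \<comment> \<open>Averaging divides the total error \<open>n * \<epsilon>\<close> of a round by
    \<open>n\<close>, so \<open>g\<close> is an \<open>\<epsilon>\<close>-accurate gradient of the
    objective.\<close>
  have "g - gradient d ?f x = (1 / real n) *\<^sub>R (s - (\<Sum>i<n. gradient d (l i) x))"
    using gradient_objective[of n d L l x] smooth Suc.prems(2)
    by (simp add: g_def scaleR_diff_right)
  also have "norm \<dots> = (1 / real n) * norm (s - (\<Sum>i<n. gradient d (l i) x))"
    by simp
  also have "\<dots> \<le> (1 / real n) * (real n * \<epsilon>)"
    using s(3) by (intro mult_left_mono) auto
  finally have err: "norm (g - gradient d ?f x) \<le> \<epsilon>"
    using n by simp
  have "?f y - ?f z \<le> L * (norm (x - z))\<^sup>2 - L * (norm (y - z))\<^sup>2 + 2 * \<epsilon> * R"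
    unfolding y_def
    by (rule pgd_step_progress[OF cvx smooth_objective[OF smooth n L] Suc.prems(2) z g err L R])
  moreover have "real (Suc j) * ?f m' \<le> real j * ?f m + ?f y"
    unfolding m'_def by (rule convex_on_running_average[OF cvx Suc.prems(3) y])
  ultimately have "real (Suc j) * ?f m' \<le> real j * ?f m + ?f z
      + L * (norm (x - z))\<^sup>2 - L * (norm (y - z))\<^sup>2 + 2 * \<epsilon> * R"
    by linarith
  moreover have "real (Suc j) * ?f z = real j * ?f z + ?f z"
    "real (Suc j) * (2 * \<epsilon> * R) = real j * (2 * \<epsilon> * R) + 2 * \<epsilon> * R"
    by (simp_all add: distrib_right)
  ultimately have "real (Suc j) * (?f m' - ?f z) + L * (norm (y - z))\<^sup>2
      \<le> L * R\<^sup>2 + real (Suc j) * (2 * \<epsilon> * R)"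
    using Suc.prems(4) unfolding right_diff_distrib by linarith
  from Suc.IH[OF run'' y m' this] show ?case
    using s(1) by simp
qed

section \<open>The query rate and the number of steps\<close>

lemma query_rate_eq:
  assumes "L > 0" "R > 0" "\<epsilon> \<ge> 0" "\<tau> > 0" "\<tau> \<ge> 5 * \<epsilon> * R"
  shows "query_rate L R \<epsilon> \<tau> = L * R\<^sup>2 / \<tau>"
proof (cases "\<epsilon> = 0")
  case False
  have "\<epsilon> * R \<ge> 0"
    using assms by simp
  then have "\<epsilon> * R \<le> \<tau>"
    using assms by linarith
  \<comment> \<open>Division by \<open>\<epsilon> * \<tau>\<close> turns this into the comparison of
    the two rates.\<close>
  then have "(L * R) * (\<epsilon> * R) \<le> (L * R) * \<tau>"
    using assms by (intro mult_left_mono) auto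
  then have "L * R\<^sup>2 / \<tau> \<le> L * R / \<epsilon>"
    using assms False by (simp add: divide_simps power2_eq_square mult_ac)
  then show ?thesis
    using False by (simp add: query_rate_def)
qed (simp add: query_rate_def)

theorem mainTheorem2:
  shows "\<exists>C::real. C > 0 \<and>
    (\<forall>(n::nat) (d::nat) (L::real) (R::real) (\<epsilon>::real) (\<tau>::real).
       n \<ge> 1 \<longrightarrow> d \<ge> 1 \<longrightarrow> L > 0 \<longrightarrow> R > 0 \<longrightarrow> \<epsilon> \<ge> 0 \<longrightarrow> \<tau> > 0 \<longrightarrow> \<tau> \<ge> 5 * \<epsilon> * R \<longrightarrow>
       (\<exists>S. legal_server n d S \<and>
          (\<forall>l wstar. R_instance n d L R l wstar \<longrightarrow>
             (\<forall>q w. run d \<epsilon> l S q w \<longrightarrow>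
                real q \<le> C * real n * query_rate L R \<epsilon> \<tau> \<and>
                objective n l w - objective n l wstar \<le> \<tau>))))"
proof (intro exI[of _ 3] conjI allI impI)
  fix n d :: nat and L R \<epsilon> \<tau> :: real
  assume n: "n \<ge> 1" and L: "L > 0" and R: "R > 0" and \<epsilon>: "\<epsilon> \<ge> 0" and \<tau>: "\<tau> > 0"
    and \<tau>_ge: "\<tau> \<ge> 5 * \<epsilon> * R"
  have rate: "query_rate L R \<epsilon> \<tau> = L * R\<^sup>2 / \<tau>"
    by (rule query_rate_eq[OF L R \<epsilon> \<tau> \<tau>_ge])
  \<comment> \<open>The gradient errors may use up \<open>2 / 5 * \<tau>\<close>, so
    \<open>L * R\<^sup>2 / k\<close> must be at most \<open>3 / 5 * \<tau>\<close>; hence the factor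
    \<open>5 / 3\<close>. For a small rate \<open>k\<close> is 0, because even a single round could
    exceed the query bound.\<close>
  define k where "k = (if L * R\<^sup>2 \<le> \<tau> then 0 else nat \<lceil>5 / 3 * (L * R\<^sup>2 / \<tau>)\<rceil>)"
  have k_le: "real k \<le> 3 * (L * R\<^sup>2 / \<tau>)"
  proof (cases "L * R\<^sup>2 \<le> \<tau>")
    case False
    \<comment> \<open>Rounding up adds less than 1, hence less than the rate itself:
      \<open>5 / 3 + 1 \<le> 3\<close> gives the constant.\<close>
    then have "L * R\<^sup>2 / \<tau> > 1"
      using \<tau> by simp
    moreover have "real_of_int \<lceil>5 / 3 * (L * R\<^sup>2 / \<tau>)\<rceil> < 5 / 3 * (L * R\<^sup>2 / \<tau>) + 1"
      by linarith
    moreover have "real k = real_of_int \<lceil>5 / 3 * (L * R\<^sup>2 / \<tau>)\<rceil>"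
      using False \<open>L * R\<^sup>2 / \<tau> > 1\<close> unfolding k_def by simp
    ultimately show ?thesis by linarith
  qed (use L \<tau> in \<open>simp add: k_def\<close>)
  show "\<exists>S. legal_server n d S \<and>
      (\<forall>l wstar. R_instance n d L R l wstar \<longrightarrow>
         (\<forall>q w. run d \<epsilon> l S q w \<longrightarrow>
            real q \<le> 3 * real n * query_rate L R \<epsilon> \<tau> \<and>
            objective n l w - objective n l wstar \<le> \<tau>))"
  proof (intro exI[of _ "pgd_server n L R k 0 0 0"] conjI allI impI)
    have zero: "0 \<in> Rd d"
      by (rule subspace_0[OF subspace_Rd])
    show "legal_server n d (pgd_server n L R k 0 0 0)"
      by (rule legal_pgd_server[OF zero zero])
    fix l z q w
    assume inst: "R_instance n d L R l z" and run: "run d \<epsilon> l (pgd_server n L R k 0 0 0) q w"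
    let ?f = "objective n l"
    have smooth: "smooth_Rd d L (l i)" if "i < n" for i
      using inst that by (simp add: R_instance_def)
    have cvx: "convex_on (Rd d) ?f"
      using inst by (intro convex_on_objective) (simp add: R_instance_def)
    have min: "minimizer d ?f z" and zR: "norm z \<le> R"
      using inst by (auto simp: R_instance_def least_norm_minimizer_def)
    have z: "z \<in> Rd d"
      using min by (simp add: minimizer_def)
    \<comment> \<open>At the start the invariant only says that \<open>z\<close> lies within
      distance \<open>R\<close> of the origin.\<close>
    have inv: "real 0 * (?f 0 - ?f z) + L * (norm (0 - z))\<^sup>2 \<le> L * R\<^sup>2 + real 0 * (2 * \<epsilon> * R)"
      using zR L by (simp add: power_mono)
    have q: "q = k * n" and bound: "real k * (?f w - ?f z) \<le> L * R\<^sup>2 + real k * (2 * \<epsilon> * R)"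
      using run_pgd_server[OF cvx smooth n L R z zR run zero zero inv] by simp_all
    show "real q \<le> 3 * real n * query_rate L R \<epsilon> \<tau>"
      using mult_right_mono[OF k_le, of "real n"] by (simp add: q rate mult_ac)
    show "?f w - ?f z \<le> \<tau>"
    proof (cases "L * R\<^sup>2 \<le> \<tau>")
      case True
      then have "w = 0"
        using run by (auto simp: k_def elim: run.cases)
      then show ?thesis
        using suboptimality_at_0[OF cvx smooth_objective[OF smooth n L] min zR L] True by simp
    next
      case False
      have "L * R\<^sup>2 / \<tau> > 0"
        using L R \<tau> by simp
      moreover have k_ge: "5 / 3 * (L * R\<^sup>2 / \<tau>) \<le> real k"
        using False by (simp add: k_def) linarith
      ultimately have k: "real k > 0"
        by linarith
      \<comment> \<open>The two shares of the accuracy, \<open>3 / 5\<close> for the exact part and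
        \<open>2 / 5\<close> for the errors, add up to \<open>\<tau>\<close>.\<close>
      have "L * R\<^sup>2 \<le> real k * (3 / 5 * \<tau>)"
        using k_ge \<tau> by (simp add: field_simps)
      moreover have "real k * (2 * \<epsilon> * R) \<le> real k * (2 / 5 * \<tau>)"
        using \<tau>_ge by (intro mult_left_mono) (auto simp: mult_ac)
      ultimately have "real k * (?f w - ?f z) \<le> real k * \<tau>"
        using bound by (simp add: algebra_simps)
      then show ?thesis
        using k by simp
    qed
  qed
qed simp

end
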